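(* Let $G=(V,E)$ be a finite undirected graph with $n$ nodes that is connected and non-bipartite, and let $X\in\mathbb R^{n\times d_x}$ be an initial node feature matrix whose rows are pairwise distinct and finite. Suppose there is a global constant $C_{param}>0$ such that each entry of each parameter matrix or vector (e.g. the $W^{(k)}$'s) and each entry of each intermediate variable (e.g. the $H^{(k)}$'s and $Z^{(k)}$'s) of the considered model lies in $[-C_{param},C_{param}]$. Then, for GATv2, GPRGNN and DAGNN, the cumulative attention matrices satisfy $$\lim_{k\to\infty}S(T^{(k)})=0,$$ and for FAGCN, $$\lim_{k\to\infty}T^{(k)}_{ij}=0\quad\text{for all } i,j\in V.$$
   Context: Notation. $V=\{1,\dots,n\}$; $d_i$ is the degree of $i$, $N(i)$ its set of neighbors. For a matrix $M$, $M_i$ is its $i$-th row viewed as a vector; $\Vert$ is concatenation; $\sigma$ is a fixed continuous activation function applied entrywise. Layers are indexed by $k=1,2,\dots$ without bound, each layer having its own parameters. Attention and cumulative attention. $\mathcal A^{(k)}=(\alpha^{(k)}_{ij})\in\mathbb R^{n\times n}$ is the edge-attention matrix (its $(i,j)$ entry is zero unless $j\in N(i)$), $\Gamma^{(k)}=\operatorname{diag}(\gamma^{(k)}_1,\dots,\gamma^{(k)}_n)$ is the hop-attention matrix, and the cumulative attention matrix is $$T^{(k)}=\Gamma^{(k)}\mathcal A^{(k)}\mathcal A^{(k-1)}\cdots\mathcal A^{(1)}.$$ Smoothness score. For $T\in\mathbb R^{n\times n}$, $$S(T)=\frac{1}{\binom n2}\sum_{\{i,j\}\in\binom{[n]}{2}}\left\Vert\frac{T_i}{\Vert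 T_i\Vert_1}-\frac{T_j}{\Vert T_j\Vert_1}\right\Vert_1,$$ with the convention that $T_i/\Vert T_i\Vert_1$ is the zero vector when $T_i=0$. Models. - GATv2: $H^{(0)}=X$, $H^{(k)}=\mathcal A^{(k)}H^{(k-1)}W^{(k)}$, $\check\alpha^{(k)}_{ij}=\exp\big((W^{(k)}_{edge})^\top\sigma(H^{(k-1)}_i\Vert H^{(k-1)}_j)\big)$, $\alpha^{(k)}_{ij}=\check\alpha^{(k)}_{ij}/\sum_{j'\in N(i)}\check\alpha^{(k)}_{ij'}$, $\gamma^{(k)}_i=1$. - FAGCN: $H^{(0)}=\sigma(XW^{(1)})$ with a learnable matrix $W^{(1)}$; $\check\alpha^{(k)}_{ij}=\tanh\big((W^{(k)}_{edge})^\top(Z^{(k-1)}_i\Vert Z^{(k-1)}_j)\big)$, $\alpha^{(k)}_{ij}=\check\alpha^{(k)}_{ij}/\sqrt{d_id_j}$, $\gamma^{(k)}_i=c_\gamma$ for all $k,i$, with $c_\gamma$ a fixed constant; $Z^{(0)}=c_\gamma H^{(0)}$, $Z^{(k)}=c_\gamma H^{(0)}+\mathcal A^{(k)}Z^{(k-1)}$. - GPRGNN: $H^{(0)}$ is obtained from $X$ by a multi-layer perceptron; $\alpha^{(k)}_{ij}=1/\sqrt{d_id_j}$, $H^{(k)}=\mathcal A^{(k)}H^{(k-1)}$, $\gamma^{(k)}_i=c_{k;\gamma}$ for all $i$, with $c_{k;\gamma}\in\mathbb R$ learnable and possibly depending on $k$. - DAGNN: as GPRGNN, except that $\gamma^{(k)}_i=\operatorname{sigmoid}(W_{hop}^\top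 H^{(k)}_i)$ with one learnable vector $W_{hop}$ shared by all layers. Learnable parameters take arbitrary values subject only to the boundedness assumption.
   Formalization: For GATv2 the layer widths (numbers of columns of the H^(k)) are additionally assumed uniformly bounded, e.g. a fixed hidden dimension; with bounded entries but unboundedly growing widths the attention logits can diverge and S(T^(k)) need not tend to 0 (e.g. on a triangle). *)

theory Defs
  imports
    Complex_Main
    "Jordan_Normal_Form.Matrix"
    "Graph_Theory.Graph_Theory"
begin

section \<open>Graphs\<close>

text \<open>Undirected graphs are symmetric pair digraphs. Self-loops are permitted but not required,
  and a self-loop makes a vertex a neighbour of itself, contributing one to its degree.\<close>

definition neighbours :: "'v pair_pre_digraph \<Rightarrow> 'v \<Rightarrow> 'v set" where
  "neighbours G i = {j. (i, j) \<in> parcs G}"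

definition degree_of :: "'v pair_pre_digraph \<Rightarrow> 'v \<Rightarrow> nat" where
  "degree_of G i = card (neighbours G i)"

definition bipartite_graph :: "'v pair_pre_digraph \<Rightarrow> bool" where
  "bipartite_graph G \<longleftrightarrow>
     (\<exists>A B. A \<union> B = pverts G \<and> A \<inter> B = {} \<and> parcs G \<subseteq> A \<times> B \<union> B \<times> A)"


section \<open>Cumulative attention and smoothness\<close>

text \<open>Vertices are \<open>0, \<dots>, n - 1\<close>, matching the row indices of matrices. Layers are numbered from
  1 on, so the value of a layer-indexed attention matrix or parameter at index 0 is never used.\<close>

primrec attention_prod :: "nat \<Rightarrow> (nat \<Rightarrow> real mat) \<Rightarrow> nat \<Rightarrow> real mat" where
  "attention_prod n A 0 = 1\<^sub>m n"
| "attention_prod n A (Suc k) = A (Suc k) * attention_prod n A k"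

definition cumulative_attention ::
    "nat \<Rightarrow> (nat \<Rightarrow> nat \<Rightarrow> real) \<Rightarrow> (nat \<Rightarrow> real mat) \<Rightarrow> nat \<Rightarrow> real mat" where
  "cumulative_attention n \<gamma> A k = mat_diag n (\<gamma> k) * attention_prod n A k"

definition l1_norm :: "real vec \<Rightarrow> real" where
  "l1_norm v = (\<Sum>i<dim_vec v. \<bar>v $ i\<bar>)"

text \<open>For the zero vector this is the zero vector, since \<open>1 / 0 = 0\<close>.\<close>

definition l1_normalize :: "real vec \<Rightarrow> real vec" where
  "l1_normalize v = (1 / l1_norm v) \<cdot>\<^sub>v v"

text \<open>Each unordered pair of distinct indices is represented by its increasing ordering.\<close>

definition smoothness :: "real mat \<Rightarrow> real" where
  "smoothness T =
     1 / real (dim_row T choose 2) *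
     (\<Sum>(i, j) \<in> {(i, j). i < j \<and> j < dim_row T}.
        l1_norm (l1_normalize (row T i) - l1_normalize (row T j)))"


section \<open>GATv2\<close>

definition gatv2_score :: "(real \<Rightarrow> real) \<Rightarrow> real vec \<Rightarrow> real mat \<Rightarrow> nat \<Rightarrow> nat \<Rightarrow> real" where
  "gatv2_score \<sigma> w H i j = exp (w \<bullet> map_vec \<sigma> (row H i @\<^sub>v row H j))"

definition gatv2_attention ::
    "nat pair_pre_digraph \<Rightarrow> (real \<Rightarrow> real) \<Rightarrow> real vec \<Rightarrow> real mat \<Rightarrow> real mat" where
  "gatv2_attention G \<sigma> w H =
     mat (card (pverts G)) (card (pverts G)) (\<lambda>(i, j).
       if j \<in> neighbours G i
       then gatv2_score \<sigma> w H i j / (\<Sum>j' \<in> neighbours G i. gatv2_score \<sigma> w H i j')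
       else 0)"

primrec gatv2_H ::
    "nat pair_pre_digraph \<Rightarrow> (real \<Rightarrow> real) \<Rightarrow> (nat \<Rightarrow> real vec) \<Rightarrow> (nat \<Rightarrow> real mat)
     \<Rightarrow> real mat \<Rightarrow> nat \<Rightarrow> real mat" where
  "gatv2_H G \<sigma> w\<^sub>e W X 0 = X"
| "gatv2_H G \<sigma> w\<^sub>e W X (Suc k) =
     gatv2_attention G \<sigma> (w\<^sub>e (Suc k)) (gatv2_H G \<sigma> w\<^sub>e W X k) * gatv2_H G \<sigma> w\<^sub>e W X k * W (Suc k)"

definition gatv2_A ::
    "nat pair_pre_digraph \<Rightarrow> (real \<Rightarrow> real) \<Rightarrow> (nat \<Rightarrow> real vec) \<Rightarrow> (nat \<Rightarrow> real mat)
     \<Rightarrow> real mat \<Rightarrow> nat \<Rightarrow> real mat" where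
  "gatv2_A G \<sigma> w\<^sub>e W X k = gatv2_attention G \<sigma> (w\<^sub>e k) (gatv2_H G \<sigma> w\<^sub>e W X (k - 1))"

definition gatv2_T ::
    "nat pair_pre_digraph \<Rightarrow> (real \<Rightarrow> real) \<Rightarrow> (nat \<Rightarrow> real vec) \<Rightarrow> (nat \<Rightarrow> real mat)
     \<Rightarrow> real mat \<Rightarrow> nat \<Rightarrow> real mat" where
  "gatv2_T G \<sigma> w\<^sub>e W X =
     cumulative_attention (card (pverts G)) (\<lambda>k i. 1) (gatv2_A G \<sigma> w\<^sub>e W X)"


section \<open>FAGCN\<close>

definition fagcn_attention ::
    "nat pair_pre_digraph \<Rightarrow> real vec \<Rightarrow> real mat \<Rightarrow> real mat" where
  "fagcn_attention G w Z =
     mat (card (pverts G)) (card (pverts G)) (\<lambda>(i, j).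
       if j \<in> neighbours G i
       then tanh (w \<bullet> (row Z i @\<^sub>v row Z j)) / sqrt (real (degree_of G i) * real (degree_of G j))
       else 0)"

definition fagcn_H0 :: "(real \<Rightarrow> real) \<Rightarrow> real mat \<Rightarrow> real mat \<Rightarrow> real mat" where
  "fagcn_H0 \<sigma> W\<^sub>1 X = map_mat \<sigma> (X * W\<^sub>1)"

primrec fagcn_Z ::
    "nat pair_pre_digraph \<Rightarrow> real \<Rightarrow> (nat \<Rightarrow> real vec) \<Rightarrow> real mat \<Rightarrow> nat \<Rightarrow> real mat" where
  "fagcn_Z G c w\<^sub>e H\<^sub>0 0 = c \<cdot>\<^sub>m H\<^sub>0"
| "fagcn_Z G c w\<^sub>e H\<^sub>0 (Suc k) =
     c \<cdot>\<^sub>m H\<^sub>0 + fagcn_attention G (w\<^sub>e (Suc k)) (fagcn_Z G c w\<^sub>e H\<^sub>0 k) * fagcn_Z G c w\<^sub>e H\<^sub>0 k"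

definition fagcn_A ::
    "nat pair_pre_digraph \<Rightarrow> real \<Rightarrow> (nat \<Rightarrow> real vec) \<Rightarrow> real mat \<Rightarrow> nat \<Rightarrow> real mat" where
  "fagcn_A G c w\<^sub>e H\<^sub>0 k = fagcn_attention G (w\<^sub>e k) (fagcn_Z G c w\<^sub>e H\<^sub>0 (k - 1))"

definition fagcn_T ::
    "nat pair_pre_digraph \<Rightarrow> real \<Rightarrow> (nat \<Rightarrow> real vec) \<Rightarrow> real mat \<Rightarrow> nat \<Rightarrow> real mat" where
  "fagcn_T G c w\<^sub>e H\<^sub>0 =
     cumulative_attention (card (pverts G)) (\<lambda>k i. c) (fagcn_A G c w\<^sub>e H\<^sub>0)"


section \<open>Multi-layer perceptrons\<close>

definition affine_layer :: "real mat \<Rightarrow> real vec \<Rightarrow> real mat \<Rightarrow> real mat" where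
  "affine_layer M b Y = mat (dim_row Y) (dim_vec b) (\<lambda>(i, j). (Y * M) $$ (i, j) + b $ j)"

primrec mlp_state ::
    "(nat \<Rightarrow> real \<Rightarrow> real) \<Rightarrow> (nat \<Rightarrow> real mat) \<Rightarrow> (nat \<Rightarrow> real vec) \<Rightarrow> real mat \<Rightarrow> nat \<Rightarrow> real mat"
  where
  "mlp_state \<phi> M b X 0 = X"
| "mlp_state \<phi> M b X (Suc l) =
     map_mat (\<phi> (Suc l)) (affine_layer (M (Suc l)) (b (Suc l)) (mlp_state \<phi> M b X l))"

text \<open>\<open>H\<^sub>0\<close>, with \<open>d\<close> columns, is the output on input \<open>X\<close> of a perceptron with at least one layer
  whose parameters and layer outputs have entries in \<open>[-C, C]\<close>. Hidden layers use the activation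
  function \<open>\<sigma>\<close>; the output layer may use \<open>\<sigma>\<close> or be linear.\<close>

definition mlp_output ::
    "(real \<Rightarrow> real) \<Rightarrow> real \<Rightarrow> real mat \<Rightarrow> nat \<Rightarrow> real mat \<Rightarrow> bool" where
  "mlp_output \<sigma> C X d H\<^sub>0 \<longleftrightarrow>
     (\<exists>L m \<phi> M b. 1 \<le> L \<and> m 0 = dim_col X \<and> m L = d \<and>
        (\<forall>l \<in> {1..<L}. \<phi> l = \<sigma>) \<and> (\<phi> L = \<sigma> \<or> \<phi> L = id) \<and>
        (\<forall>l \<in> {1..L}.
           M l \<in> carrier_mat (m (l - 1)) (m l) \<and> elements_mat (M l) \<subseteq> {-C..C} \<and>
           b l \<in> carrier_vec (m l) \<and> set\<^sub>v (b l) \<subseteq> {-C..C} \<and>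
           elements_mat (mlp_state \<phi> M b X l) \<subseteq> {-C..C}) \<and>
        H\<^sub>0 = mlp_state \<phi> M b X L)"


section \<open>GPRGNN and DAGNN\<close>

definition sym_norm_attention :: "nat pair_pre_digraph \<Rightarrow> real mat" where
  "sym_norm_attention G =
     mat (card (pverts G)) (card (pverts G)) (\<lambda>(i, j).
       if j \<in> neighbours G i
       then 1 / sqrt (real (degree_of G i) * real (degree_of G j))
       else 0)"

text \<open>The hidden features \<open>H k\<close> are the same for both models.\<close>

primrec propagate_H :: "nat pair_pre_digraph \<Rightarrow> real mat \<Rightarrow> nat \<Rightarrow> real mat" where
  "propagate_H G H\<^sub>0 0 = H\<^sub>0"
| "propagate_H G H\<^sub>0 (Suc k) = sym_norm_attention G * propagate_H G H\<^sub>0 k"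

definition gprgnn_T :: "nat pair_pre_digraph \<Rightarrow> (nat \<Rightarrow> real) \<Rightarrow> nat \<Rightarrow> real mat" where
  "gprgnn_T G c =
     cumulative_attention (card (pverts G)) (\<lambda>k i. c k) (\<lambda>k. sym_norm_attention G)"

definition sigmoid :: "real \<Rightarrow> real" where
  "sigmoid x = 1 / (1 + exp (- x))"

definition dagnn_T :: "nat pair_pre_digraph \<Rightarrow> real vec \<Rightarrow> real mat \<Rightarrow> nat \<Rightarrow> real mat" where
  "dagnn_T G w\<^sub>h H\<^sub>0 =
     cumulative_attention (card (pverts G))
       (\<lambda>k i. sigmoid (w\<^sub>h \<bullet> row (propagate_H G H\<^sub>0 k) i)) (\<lambda>k. sym_norm_attention G)"

end

theory Submission
  imports Defs
begin

text \<open>For GATv2, GPRGNN and DAGNN the attention matrices become row-stochastic after conjugation by a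
  fixed positive diagonal matrix, with entries on the edges bounded away from zero. As the graph is
  connected and not bipartite, some \<open>m\<close> is the length of a walk between any two vertices, so any
  \<open>m\<close> consecutive averaging steps shrink the range of a column by a fixed factor. Hence the rows
  of the products approach each other, and so do the normalised rows, which see hop attention only
  through its sign, and that sign is the same for all rows. For FAGCN, boundedness keeps the
  hyperbolic tangents below some \<open>t < 1\<close>, so the products decay like \<open>t ^ k\<close>.\<close>

section \<open>Walks of a common length in a connected non-bipartite relation\<close>

lemma sym_relpow:
  assumes "sym E" and "(a, b) \<in> E ^^ k"
  shows "(b, a) \<in> E ^^ k"
  using assms(2)
proof (induction k arbitrary: b)
  case (Suc k)
  then obtain c where "(a, c) \<in> E ^^ k" "(c, b) \<in> E" by auto
  then have "(c, a) \<in> E ^^ k" "(b, c) \<in> E"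
    using Suc.IH \<open>sym E\<close> by (auto dest: symD)
  then show ?case by (rule relpow_Suc_I2[rotated])
qed simp

text \<open>The vertices reached from \<open>v\<close> by even and by odd walks would form a bipartition unless they
  overlap; an overlap closes up to an odd walk at \<open>v\<close>, which makes closed walks of all large
  lengths.\<close>

lemma common_walk_length:
  assumes "finite V" and "V \<noteq> {}" and "sym E" and "E \<subseteq> V \<times> V"
    and conn: "\<And>u v. u \<in> V \<Longrightarrow> v \<in> V \<Longrightarrow> (u, v) \<in> E\<^sup>*"
    and nonbip: "\<And>A B. A \<union> B = V \<Longrightarrow> A \<inter> B = {} \<Longrightarrow> \<not> E \<subseteq> A \<times> B \<union> B \<times> A"
  obtains m where "m > 0" and "\<And>u v. u \<in> V \<Longrightarrow> v \<in> V \<Longrightarrow> (u, v) \<in> E ^^ m"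
proof -
  obtain v where v: "v \<in> V" using \<open>V \<noteq> {}\<close> by blast
  define A where "A = {u \<in> V. \<exists>k. even k \<and> (v, u) \<in> E ^^ k}"
  define B where "B = {u \<in> V. \<exists>k. odd k \<and> (v, u) \<in> E ^^ k}"
  have "A \<union> B = V"
    using conn[OF v] unfolding A_def B_def rtrancl_power by blast
  moreover have "E \<subseteq> A \<times> B \<union> B \<times> A"
  proof (rule subrelI)
    fix a b assume ab: "(a, b) \<in> E"
    with \<open>E \<subseteq> V \<times> V\<close> have "a \<in> V" "b \<in> V" by auto
    moreover from conn[OF v \<open>a \<in> V\<close>] obtain k where k: "(v, a) \<in> E ^^ k"
      unfolding rtrancl_power by blast
    moreover from k ab have "(v, b) \<in> E ^^ Suc k" by auto
    moreover have "even k \<longleftrightarrow> odd (Suc k)" by simp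
    ultimately show "(a, b) \<in> A \<times> B \<union> B \<times> A"
      unfolding A_def B_def by blast
  qed
  ultimately have "A \<inter> B \<noteq> {}" using nonbip by blast
  then obtain u k l where "even k" "(v, u) \<in> E ^^ k" "odd l" "(v, u) \<in> E ^^ l"
    unfolding A_def B_def by blast
  then have "odd (k + l)" and closed: "(v, v) \<in> E ^^ (k + l)"
    by (auto intro: relpow_trans sym_relpow[OF \<open>sym E\<close>])
  define r where "r = k + l"
  have r: "odd r" "(v, v) \<in> E ^^ r" using \<open>odd (k + l)\<close> closed by (auto simp: r_def)
  \<comment> \<open>Going back and forth along one edge at \<open>v\<close> uses up any even length.
    Such an edge exists because the closed walk of odd length \<open>r\<close> is not empty.\<close>
  have even_walk: "(v, v) \<in> E ^^ (2 * s)" for s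
  proof (induction s)
    case (Suc s)
    obtain w where "(v, w) \<in> E"
      using r by (cases r) (simp, metis relpow_Suc_E2)
    then have "(v, v) \<in> E ^^ 2"
      using \<open>sym E\<close> by (auto simp: numeral_2_eq_2 dest: symD)
    from relpow_trans[OF Suc this] show ?case by simp
  qed simp
  have long_walk: "(v, v) \<in> E ^^ L" if "r \<le> L" for L
  proof (cases "even L")
    case True
    then show ?thesis using even_walk[of "L div 2"] by simp
  next
    case False
    with r(1) that have "L = r + 2 * ((L - r) div 2)" by simp
    then show ?thesis using relpow_trans[OF r(2) even_walk] by metis
  qed
  from conn[OF v] have "\<forall>u\<in>V. \<exists>k. (v, u) \<in> E ^^ k" unfolding rtrancl_power by blast
  then obtain f where f: "\<And>u. u \<in> V \<Longrightarrow> (v, u) \<in> E ^^ f u" by metis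
  define N where "N = Max (f ` V)"
  have N: "f u \<le> N" if "u \<in> V" for u
    using that \<open>finite V\<close> by (auto simp: N_def)
  show ?thesis
  proof
    show "r + 2 * N > 0" using r(1) by (cases r) auto
    fix a b assume ab: "a \<in> V" "b \<in> V"
    \<comment> \<open>The walk goes from \<open>a\<close> to \<open>v\<close>, around a closed walk
      at \<open>v\<close>, and on to \<open>b\<close>. The middle length \<open>L\<close> absorbs
      the differing outer lengths and is at least \<open>r\<close> since both outer lengths are at
      most \<open>N\<close>.\<close>
    define L where "L = r + 2 * N - f a - f b"
    have "r \<le> L" "f a + L + f b = r + 2 * N" using N[OF ab(1)] N[OF ab(2)] by (auto simp: L_def)
    then show "(a, b) \<in> E ^^ (r + 2 * N)"
      using relpow_trans[OF relpow_trans[OF sym_relpow[OF \<open>sym E\<close> f[OF ab(1)]] long_walk] f[OF ab(2)]]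
      by metis
  qed
qed

section \<open>Consensus under repeated averaging\<close>

text \<open>Since the weights sum to one, the excess over \<open>lo\<close> is averaged by the same
  weights as \<open>x\<close>. It therefore stays nonnegative, and each edge of a walk passes on at
  least the fraction \<epsilon> of the excess at its endpoint.\<close>

lemma averaging_lower_bound:
  fixes x :: "nat \<Rightarrow> 'a \<Rightarrow> real"
  assumes "finite V" and "E \<subseteq> V \<times> V" and "0 \<le> \<epsilon>"
    and nonneg: "\<And>k i l. i \<in> V \<Longrightarrow> l \<in> V \<Longrightarrow> 0 \<le> Q k i l"
    and sum1: "\<And>k i. i \<in> V \<Longrightarrow> (\<Sum>l\<in>V. Q k i l) = 1"
    and edge: "\<And>k i l. (i, l) \<in> E \<Longrightarrow> \<epsilon> \<le> Q k i l"
    and step: "\<And>k i. i \<in> V \<Longrightarrow> x (Suc k) i = (\<Sum>l\<in>V. Q k i l * x k l)"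
    and lo: "\<And>v. v \<in> V \<Longrightarrow> lo \<le> x k v"
  shows "i \<in> V \<Longrightarrow> lo \<le> x (k + r) i"
    and "(i, l) \<in> E ^^ r \<Longrightarrow> i \<in> V \<Longrightarrow> lo + \<epsilon> ^ r * (x k l - lo) \<le> x (k + r) i"
proof -
  have shift: "x (Suc k) i - c = (\<Sum>l\<in>V. Q k i l * (x k l - c))" if "i \<in> V" for k i c
    using step[OF that] sum1[OF that]
    by (simp add: right_diff_distrib sum_subtractf flip: sum_distrib_right)
  have lower: "i \<in> V \<Longrightarrow> lo \<le> x (k + r) i" for i r
  proof (induction r arbitrary: i)
    case (Suc r)
    have "0 \<le> (\<Sum>l\<in>V. Q (k + r) i l * (x (k + r) l - lo))"
      using Suc by (intro sum_nonneg mult_nonneg_nonneg nonneg) auto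
    then show ?case using shift[of i "k + r" lo] Suc.prems by simp
  qed (simp add: lo)
  then show "i \<in> V \<Longrightarrow> lo \<le> x (k + r) i" .
  show "(i, l) \<in> E ^^ r \<Longrightarrow> i \<in> V \<Longrightarrow> lo + \<epsilon> ^ r * (x k l - lo) \<le> x (k + r) i"
  proof (induction r arbitrary: i)
    case (Suc r)
    then obtain j where j: "(i, j) \<in> E" "(j, l) \<in> E ^^ r" by (meson relpow_Suc_D2)
    then have "j \<in> V" using \<open>E \<subseteq> V \<times> V\<close> by auto
    \<comment> \<open>Of the average at \<open>i\<close> only the term of the first edge
      \<open>(i, j)\<close> is kept; the others are nonnegative by \<open>lower\<close>.\<close>
    have "\<epsilon> ^ Suc r * (x k l - lo) = \<epsilon> * (\<epsilon> ^ r * (x k l - lo))" by simp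
    also have "\<dots> \<le> \<epsilon> * (x (k + r) j - lo)"
      using Suc.IH[OF j(2) \<open>j \<in> V\<close>] \<open>0 \<le> \<epsilon>\<close> by (intro mult_left_mono) auto
    also have "\<dots> \<le> Q (k + r) i j * (x (k + r) j - lo)"
      using edge[OF j(1)] lower[OF \<open>j \<in> V\<close>] by (intro mult_right_mono) auto
    also have "\<dots> \<le> (\<Sum>l\<in>V. Q (k + r) i l * (x (k + r) l - lo))"
      using \<open>finite V\<close> \<open>j \<in> V\<close> Suc.prems lower nonneg by (intro member_le_sum) auto
    also have "\<dots> = x (k + Suc r) i - lo" using shift[OF Suc.prems(2)] by simp
    finally show ?case by simp
  qed simp
qed

text \<open>A contraction of Doeblin type: over \<open>m\<close> steps every vertex gives a common
  vertex a total weight of at least \<open>\<epsilon> ^ m\<close>, so an interval containing all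
  values shrinks by the factor \<open>1 - \<epsilon> ^ m\<close> per block of \<open>m\<close>
  steps.\<close>

lemma averaging_consensus:
  fixes x :: "nat \<Rightarrow> 'a \<Rightarrow> real"
  assumes "finite V" and "E \<subseteq> V \<times> V" and "0 < \<epsilon>" and "\<epsilon> \<le> 1" and "0 < m"
    and walk: "\<And>u v. u \<in> V \<Longrightarrow> v \<in> V \<Longrightarrow> (u, v) \<in> E ^^ m"
    and nonneg: "\<And>k i l. i \<in> V \<Longrightarrow> l \<in> V \<Longrightarrow> 0 \<le> Q k i l"
    and sum1: "\<And>k i. i \<in> V \<Longrightarrow> (\<Sum>l\<in>V. Q k i l) = 1"
    and edge: "\<And>k i l. (i, l) \<in> E \<Longrightarrow> \<epsilon> \<le> Q k i l"
    and step: "\<And>k i. i \<in> V \<Longrightarrow> x (Suc k) i = (\<Sum>l\<in>V. Q k i l * x k l)"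
    and "i \<in> V" and "j \<in> V"
  shows "(\<lambda>k. x k i - x k j) \<longlonglongrightarrow> 0"
proof -
  define \<delta> where "\<delta> = \<epsilon> ^ m"
  have \<delta>: "0 < \<delta>" "\<delta> \<le> 1" using \<open>0 < \<epsilon>\<close> \<open>\<epsilon> \<le> 1\<close> by (auto simp: \<delta>_def power_le_one)
  define B where "B = Max (x 0 ` V) - Min (x 0 ` V)"
  note lower = averaging_lower_bound[OF \<open>finite V\<close> \<open>E \<subseteq> V \<times> V\<close> less_imp_le[OF \<open>0 < \<epsilon>\<close>]
      nonneg sum1 edge]
  \<comment> \<open>The negated values obey the same recursion, so lower bounds for them are upper
    bounds for \<open>x\<close>.\<close>
  have step': "- x (Suc k) i = (\<Sum>l\<in>V. Q k i l * - x k l)" if "i \<in> V" for k i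
    using step[OF that] by (simp add: sum_negf)
  have between: "lo \<le> x (k + r) v \<and> x (k + r) v \<le> hi"
    if "\<And>u. u \<in> V \<Longrightarrow> lo \<le> x k u \<and> x k u \<le> hi" "v \<in> V" for lo hi k r v
    using that lower(1)[where x = x and lo = lo, OF _ _ _ _ step]
      lower(1)[where x = "\<lambda>k v. - x k v" and lo = "- hi", OF _ _ _ _ step'] by simp
  \<comment> \<open>The interval serves all later times, not only the multiples of \<open>m\<close>,
    because averages never leave an interval that contains the averaged values.\<close>
  have shrink: "\<exists>lo hi. hi - lo = (1 - \<delta>) ^ q * B \<and>
      (\<forall>k\<ge>q * m. \<forall>v\<in>V. lo \<le> x k v \<and> x k v \<le> hi)" for q
  proof (induction q)
    case 0
    have "Min (x 0 ` V) \<le> x k v \<and> x k v \<le> Max (x 0 ` V)" if "v \<in> V" for k v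
      using between[of "Min (x 0 ` V)" 0 "Max (x 0 ` V)" v k] that \<open>finite V\<close> by auto
    then show ?case unfolding B_def by (intro exI) auto
  next
    case (Suc q)
    then obtain lo hi where len: "hi - lo = (1 - \<delta>) ^ q * B"
      and box: "\<And>k v. k \<ge> q * m \<Longrightarrow> v \<in> V \<Longrightarrow> lo \<le> x k v \<and> x k v \<le> hi" by blast
    \<comment> \<open>Every vertex reaches the one vertex \<open>i\<close> in \<open>m\<close> steps
      and is pulled towards its value \<open>y\<close>. The endpoints move in by
      \<open>\<delta> * (y - lo)\<close> and \<open>\<delta> * (hi - y)\<close>, which add up to
      \<open>\<delta> * (hi - lo)\<close> whatever \<open>y\<close> is.\<close>
    define y where "y = x (q * m) i"
    let ?lo = "lo + \<delta> * (y - lo)" and ?hi = "hi - \<delta> * (hi - y)"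
    have "?lo \<le> x (q * m + m) v \<and> x (q * m + m) v \<le> ?hi" if "v \<in> V" for v
      using lower(2)[where x = x and lo = lo and k = "q * m",
          OF _ _ _ _ step _ walk[OF that \<open>i \<in> V\<close>] that]
        lower(2)[where x = "\<lambda>k v. - x k v" and lo = "- hi" and k = "q * m",
          OF _ _ _ _ step' _ walk[OF that \<open>i \<in> V\<close>] that]
        box[of "q * m"] by (simp add: \<delta>_def y_def algebra_simps)
    then have "?lo \<le> x (q * m + m + r) v \<and> x (q * m + m + r) v \<le> ?hi" if "v \<in> V" for v r
      using between that by blast
    then have "?lo \<le> x k v \<and> x k v \<le> ?hi" if "k \<ge> Suc q * m" "v \<in> V" for k v
      using that(2) le_Suc_ex[OF that(1)] by (auto simp: add.commute add.assoc)
    moreover have "?hi - ?lo = (1 - \<delta>) ^ Suc q * B"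
      using len by (simp add: algebra_simps)
    ultimately show ?case by blast
  qed
  show ?thesis
  proof (rule LIMSEQ_I)
    fix e :: real assume "0 < e"
    have "(\<lambda>q. (1 - \<delta>) ^ q * B) \<longlonglongrightarrow> 0 * B"
      using \<delta> by (intro tendsto_mult LIMSEQ_power_zero tendsto_const) auto
    then have "\<forall>\<^sub>F q in sequentially. (1 - \<delta>) ^ q * B < e"
      using \<open>0 < e\<close> by (intro order_tendstoD(2)) auto
    then obtain q where "(1 - \<delta>) ^ q * B < e"
      by (auto simp: eventually_sequentially)
    with shrink[of q] obtain lo hi where "hi - lo < e"
      and "\<forall>k\<ge>q * m. \<forall>v\<in>V. lo \<le> x k v \<and> x k v \<le> hi" by metis
    then have "norm (x k i - x k j - 0) < e" if "k \<ge> q * m" for k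
      using that \<open>i \<in> V\<close> \<open>j \<in> V\<close> by (smt (verit) real_norm_def)
    then show "\<exists>no. \<forall>k\<ge>no. norm (x k i - x k j - 0) < e" by blast
  qed
qed

section \<open>From agreeing rows to the smoothness score\<close>

text \<open>Each \<open>T k\<close> is a row-stochastic matrix scaled by \<open>a\<close> on the
  rows and \<open>w\<close> on the columns. Normalising a row cancels the size of
  \<open>a k i\<close> and keeps its sign; the remaining divisor is an average of the weights
  \<open>w\<close>, hence bounded away from zero, and dividing by it preserves the
  convergence.\<close>

lemma smoothness_tendsto_0:
  fixes T :: "nat \<Rightarrow> real mat"
  assumes T: "\<And>k. T k \<in> carrier_mat n n"
    and entry: "\<And>k i j. i < n \<Longrightarrow> j < n \<Longrightarrow> T k $$ (i, j) = a k i * p k i j * w j"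
    and w: "\<And>j. j < n \<Longrightarrow> 0 < w j"
    and p: "\<And>k i j. i < n \<Longrightarrow> j < n \<Longrightarrow> 0 \<le> p k i j"
    and sum1: "\<And>k i. i < n \<Longrightarrow> (\<Sum>j<n. p k i j) = 1"
    and sgn: "\<And>k i j. i < n \<Longrightarrow> j < n \<Longrightarrow> sgn (a k i) = sgn (a k j)"
    and lim: "\<And>i i' j. i < n \<Longrightarrow> i' < n \<Longrightarrow> j < n \<Longrightarrow> (\<lambda>k. p k i j - p k i' j) \<longlonglongrightarrow> 0"
  shows "(\<lambda>k. smoothness (T k)) \<longlonglongrightarrow> 0"
proof -
  have dim: "dim_row (T k) = n" "dim_col (T k) = n" for k using T[of k] by auto
  define \<mu> where "\<mu> = Min (w ` {..<n})"
  have \<mu>_le: "\<mu> \<le> w j" if "j < n" for j using that by (auto simp: \<mu>_def)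
  define q where "q k i = (\<Sum>j<n. p k i j * w j)" for k i
  define \<rho> where "\<rho> k i j = sgn (a k i) * w j * (p k i j / q k i)" for k i j
  have q_ge: "\<mu> \<le> q k i" if "i < n" for k i
  proof -
    have "\<mu> = (\<Sum>j<n. p k i j * \<mu>)" using sum1[OF that] by (simp flip: sum_distrib_right)
    also have "\<dots> \<le> q k i" unfolding q_def
      using p[OF that] \<mu>_le by (intro sum_mono mult_left_mono) auto
    finally show ?thesis .
  qed
  \<comment> \<open>For \<open>n = 0\<close> this would be the minimum of an empty set, so
    positivity is claimed only in the presence of an index.\<close>
  have \<mu>_pos: "0 < \<mu>" if "i < n" for i
    unfolding \<mu>_def using that w by (subst Min_gr_iff) auto
  have norm_row: "l1_norm (row (T k) i) = \<bar>a k i\<bar> * q k i" if "i < n" for k i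
    using that p w by (simp add: l1_norm_def dim q_def entry abs_mult sum_distrib_left mult.assoc abs_of_pos
        cong: sum.cong_simp)
  \<comment> \<open>If \<open>a k i = 0\<close>, the normalised row is zero by convention, which
    agrees with \<open>sgn 0 = 0\<close>.\<close>
  have normalized: "l1_normalize (row (T k) i) $ j = \<rho> k i j" if "i < n" "j < n" for k i j
    using that by (cases "a k i = 0")
      (simp_all add: l1_normalize_def norm_row dim entry \<rho>_def sgn_real_def divide_simps abs_if)
  have dim_normalized: "dim_vec (l1_normalize (row (T k) i)) = n" for k i
    by (simp add: l1_normalize_def dim)
  have score: "smoothness (T k) = 1 / real (n choose 2) *
      (\<Sum>(i, j)\<in>{(i, j). i < j \<and> j < n}. \<Sum>l<n. \<bar>\<rho> k i l - \<rho> k j l\<bar>)" for k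
    unfolding smoothness_def dim
    by (intro arg_cong2[where f = "(*)"] sum.cong refl)
      (auto simp: l1_norm_def dim_normalized normalized)
  have q_lim: "(\<lambda>k. q k j - q k i) \<longlonglongrightarrow> 0" if "i < n" "j < n" for i j
    unfolding q_def sum_subtractf[symmetric] left_diff_distrib[symmetric]
    using that by (intro tendsto_null_sum tendsto_mult_left_zero lim) auto
  have ratio_lim: "(\<lambda>k. p k i l / q k i - p k j l / q k j) \<longlonglongrightarrow> 0"
    if i: "i < n" and j: "j < n" and l: "l < n" for i j l
  proof (rule tendsto_0_le[where K = 1])
    \<comment> \<open>The difference of quotients splits into a difference of numerators and one of
      denominators; \<open>p k j l \<le> 1\<close> and the lower bound \<mu> on the denominators
      make the remaining factors constant.\<close>
    have "norm (p k i l / q k i - p k j l / q k j)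
        \<le> \<bar>p k i l - p k j l\<bar> * (1 / \<mu>) + \<bar>q k j - q k i\<bar> * (1 / (\<mu> * \<mu>))" for k
    proof -
      have \<mu>: "0 < \<mu>" by (rule \<mu>_pos[OF i])
      have qi: "\<mu> \<le> q k i" "\<mu> \<le> q k j" using q_ge i j by auto
      have pos: "0 < q k i" "0 < q k j" using \<mu> qi by auto
      have "p k j l \<le> (\<Sum>l<n. p k j l)" using p[OF j] l by (intro member_le_sum) auto
      then have p1: "p k j l \<le> 1" using sum1[OF j] by simp
      have "p k i l / q k i - p k j l / q k j
          = (p k i l - p k j l) * (1 / q k i) + p k j l * ((q k j - q k i) * (1 / (q k i * q k j)))"
        using pos by (simp add: field_simps)
      also have "norm \<dots> \<le> \<bar>p k i l - p k j l\<bar> * (1 / q k i)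
          + p k j l * (\<bar>q k j - q k i\<bar> * (1 / (q k i * q k j)))"
        using pos p[OF j l] by (intro norm_triangle_mono) (auto simp: abs_mult)
      also have "\<dots> \<le> \<bar>p k i l - p k j l\<bar> * (1 / \<mu>) + 1 * (\<bar>q k j - q k i\<bar> * (1 / (\<mu> * \<mu>)))"
        using \<mu> qi p1 p[OF j l] pos
        by (intro add_mono mult_mono mult_left_mono divide_left_mono mult_pos_pos) auto
      finally show ?thesis by simp
    qed
    then show "\<forall>\<^sub>F k in sequentially. norm (p k i l / q k i - p k j l / q k j)
        \<le> norm (\<bar>p k i l - p k j l\<bar> * (1 / \<mu>) + \<bar>q k j - q k i\<bar> * (1 / (\<mu> * \<mu>))) * 1"
      unfolding mult_1_right real_norm_def by (intro always_eventually allI order_trans[OF _ abs_ge_self])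
    show "(\<lambda>k. \<bar>p k i l - p k j l\<bar> * (1 / \<mu>) + \<bar>q k j - q k i\<bar> * (1 / (\<mu> * \<mu>))) \<longlonglongrightarrow> 0"
      using that by (intro tendsto_add_zero tendsto_mult_left_zero tendsto_rabs_zero lim q_lim)
  qed
  have \<rho>_lim: "(\<lambda>k. \<bar>\<rho> k i l - \<rho> k j l\<bar>) \<longlonglongrightarrow> 0" if "i < n" "j < n" "l < n" for i j l
  proof (rule tendsto_0_le[where K = 1])
    have "norm \<bar>\<rho> k i l - \<rho> k j l\<bar> \<le> w l * \<bar>p k i l / q k i - p k j l / q k j\<bar>" for k
    proof -
      have "\<rho> k i l - \<rho> k j l = sgn (a k i) * (w l * (p k i l / q k i - p k j l / q k j))"
        using sgn[OF that(1,2), of k] by (simp add: \<rho>_def algebra_simps)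
      then show ?thesis using w[OF that(3)] by (simp add: abs_mult abs_sgn_eq)
    qed
    then show "\<forall>\<^sub>F k in sequentially. norm \<bar>\<rho> k i l - \<rho> k j l\<bar>
        \<le> norm (w l * \<bar>p k i l / q k i - p k j l / q k j\<bar>) * 1"
      unfolding mult_1_right real_norm_def by (intro always_eventually allI order_trans[OF _ abs_ge_self])
    show "(\<lambda>k. w l * \<bar>p k i l / q k i - p k j l / q k j\<bar>) \<longlonglongrightarrow> 0"
      using that by (intro tendsto_mult_right_zero tendsto_rabs_zero ratio_lim)
  qed
  show ?thesis unfolding score case_prod_unfold
    by (intro tendsto_mult_right_zero tendsto_null_sum \<rho>_lim) auto
qed

section \<open>Entries of attention products\<close>

lemma attention_prod_carrier:
  fixes A :: "nat \<Rightarrow> real mat"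
  shows "(\<And>k. A k \<in> carrier_mat n n) \<Longrightarrow> attention_prod n A k \<in> carrier_mat n n"
  by (induction k) (auto intro: mult_carrier_mat)

lemma attention_prod_Suc_index:
  assumes "\<And>k. A k \<in> carrier_mat n n" and "i < n" and "j < n"
  shows "attention_prod n A (Suc k) $$ (i, j)
    = (\<Sum>l<n. A (Suc k) $$ (i, l) * attention_prod n A k $$ (l, j))"
  using attention_prod_carrier[of A n k, OF assms(1)] assms(1)[of "Suc k"] assms(2,3)
  by (simp add: scalar_prod_def atLeast0LessThan)

lemma cumulative_attention_carrier:
  fixes A :: "nat \<Rightarrow> real mat"
  shows "(\<And>k. A k \<in> carrier_mat n n) \<Longrightarrow> cumulative_attention n \<gamma> A k \<in> carrier_mat n n"
  unfolding cumulative_attention_def by (intro mult_carrier_mat[OF mat_diag_dim] attention_prod_carrier)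

lemma cumulative_attention_index:
  assumes "\<And>k. A k \<in> carrier_mat n n" and "i < n" and "j < n"
  shows "cumulative_attention n \<gamma> A k $$ (i, j) = \<gamma> k i * attention_prod n A k $$ (i, j)"
  using assms(2,3)
  by (simp add: cumulative_attention_def mat_diag_mult_left[OF attention_prod_carrier[OF assms(1)]])

section \<open>Walks and degrees in the graph\<close>

lemma neighbours_subset:
  assumes "pair_pseudo_graph G"
  shows "neighbours G i \<subseteq> pverts G"
proof -
  interpret pair_pseudo_graph G by (rule assms)
  show ?thesis using in_arcsD2 by (auto simp: neighbours_def)
qed

text \<open>Symmetry of the arcs upgrades connectedness to strong connectedness, whose definition
  also provides a vertex.\<close>

lemma graph_common_walk_length:
  assumes G: "pair_pseudo_graph G"
    and conn: "Digraph_Component.connected (with_proj G)"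
    and nonbip: "\<not> bipartite_graph G"
  obtains m where "m > 0" and "\<And>u v. u \<in> pverts G \<Longrightarrow> v \<in> pverts G \<Longrightarrow> (u, v) \<in> parcs G ^^ m"
proof -
  interpret pair_pseudo_graph G by (rule G)
  have "strongly_connected (with_proj G)"
    using symmetric_connected_imp_strongly_connected sym_arcs conn by blast
  then have "pverts G \<noteq> {}" and "\<And>u v. u \<in> pverts G \<Longrightarrow> v \<in> pverts G \<Longrightarrow> (u, v) \<in> (parcs G)\<^sup>*"
    using reachable_rtranclI[of "with_proj G"] by (auto simp: strongly_connected_def)
  moreover have "parcs G \<subseteq> pverts G \<times> pverts G" using wellformed' by auto
  moreover have "sym (parcs G)" using arcs_symmetric by (auto intro: symI)
  moreover have "\<And>A B. A \<union> B = pverts G \<Longrightarrow> A \<inter> B = {} \<Longrightarrow> \<not> parcs G \<subseteq> A \<times> B \<union> B \<times> A"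
    using nonbip unfolding bipartite_graph_def by blast
  ultimately show ?thesis
    using common_walk_length[OF pair_finite_verts] that by metis
qed

text \<open>A closed walk of positive length at \<open>i\<close> starts with an edge, so
  \<open>i\<close> has a neighbour. This covers a single vertex too, where non-bipartiteness forces
  a self-loop.\<close>

lemma degree_of_bounds:
  fixes G :: "nat pair_pre_digraph"
  assumes "pair_pseudo_graph G" and "pverts G = {0..<n}"
    and "Digraph_Component.connected (with_proj G)" and "\<not> bipartite_graph G" and "i < n"
  shows "0 < degree_of G i" and "degree_of G i \<le> n"
proof -
  obtain m where "m > 0" "(i, i) \<in> parcs G ^^ m"
    using graph_common_walk_length[OF assms(1,3,4)] assms(2,5) by (metis atLeastLessThan_iff le0)
  then obtain j where "(i, j) \<in> parcs G" by (cases m) (simp, metis relpow_Suc_E2)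
  then have "j \<in> neighbours G i" by (simp add: neighbours_def)
  moreover have sub: "neighbours G i \<subseteq> {0..<n}" using neighbours_subset[OF assms(1)] assms(2) by simp
  then have "finite (neighbours G i)" by (rule finite_subset) simp
  ultimately show "0 < degree_of G i" by (auto simp: degree_of_def card_gt_0_iff)
  show "degree_of G i \<le> n" using card_mono[OF _ sub] by (simp add: degree_of_def)
qed

section \<open>Row-stochastic conjugates of attention matrices\<close>

text \<open>Conjugating by the positive diagonal matrix with entries \<open>s\<close> makes the attention matrices
  row-stochastic: \<open>s\<close> is constant for GATv2 and the square root of the degree for the
  symmetric normalisation.\<close>

lemma smoothness_cumulative_attention:
  fixes s :: "nat \<Rightarrow> real"
  assumes G: "pair_pseudo_graph G" "pverts G = {0..<n}"
      "Digraph_Component.connected (with_proj G)" "\<not> bipartite_graph G"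
    and A: "\<And>k. A k \<in> carrier_mat n n"
    and "0 < \<epsilon>" and "\<epsilon> \<le> 1"
    and s: "\<And>i. i < n \<Longrightarrow> 0 < s i"
    and nonneg: "\<And>k i l. i < n \<Longrightarrow> l < n \<Longrightarrow> 0 \<le> A (Suc k) $$ (i, l)"
    and row_sum: "\<And>k i. i < n \<Longrightarrow> (\<Sum>l<n. A (Suc k) $$ (i, l) * s l) = s i"
    and edge: "\<And>k i l. i < n \<Longrightarrow> l \<in> neighbours G i \<Longrightarrow> \<epsilon> \<le> A (Suc k) $$ (i, l) * s l / s i"
    and sgn: "\<And>k i j. i < n \<Longrightarrow> j < n \<Longrightarrow> sgn (\<gamma> k i) = sgn (\<gamma> k j)"
  shows "(\<lambda>k. smoothness (cumulative_attention n \<gamma> A k)) \<longlonglongrightarrow> 0"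
proof -
  obtain m where "0 < m" and walk: "\<And>u v. u \<in> {..<n} \<Longrightarrow> v \<in> {..<n} \<Longrightarrow> (u, v) \<in> parcs G ^^ m"
    using graph_common_walk_length[OF G(1,3,4)] G(2) by (metis atLeast0LessThan)
  interpret pair_pseudo_graph G by (rule G)
  have E: "parcs G \<subseteq> {..<n} \<times> {..<n}"
    using wellformed' G(2) by (auto simp: atLeast0LessThan)
  \<comment> \<open>\<open>Q k\<close> is the conjugate of the attention matrix of layer
    \<open>Suc k\<close>, and \<open>p k\<close> that of the product of the first \<open>k\<close>
    layers. The shift makes \<open>Q k\<close> the step from \<open>p k\<close> to
    \<open>p (Suc k)\<close>.\<close>
  define Q where "Q k i l = A (Suc k) $$ (i, l) * s l / s i" for k i l
  define p where "p k i j = attention_prod n A k $$ (i, j) * s j / s i" for k i j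
  have p_Suc: "p (Suc k) i j = (\<Sum>l<n. Q k i l * p k l j)" if "i < n" "j < n" for k i j
  proof -
    have "(\<Sum>l<n. Q k i l * p k l j)
        = (\<Sum>l<n. A (Suc k) $$ (i, l) * attention_prod n A k $$ (l, j) * (s j / s i))"
      using s that by (intro sum.cong) (auto simp: Q_def p_def less_imp_neq[THEN not_sym])
    then show ?thesis
      unfolding p_def attention_prod_Suc_index[OF A that]
      by (simp add: sum_distrib_right sum_divide_distrib)
  qed
  have Q_nonneg: "0 \<le> Q k i l" if "i < n" "l < n" for k i l
    using nonneg[OF that] s that by (simp add: Q_def less_imp_le)
  have Q_sum: "(\<Sum>l<n. Q k i l) = 1" if "i < n" for k i
    using row_sum[OF that, of k] s[OF that] by (simp add: Q_def flip: sum_divide_distrib)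
  have p_nonneg: "0 \<le> p k i j" if "i < n" "j < n" for k i j
    using that
  proof (induction k arbitrary: i)
    case 0
    then show ?case using s by (simp add: p_def less_imp_le)
  next
    case (Suc k)
    then show ?case unfolding p_Suc[OF Suc.prems]
      by (intro sum_nonneg mult_nonneg_nonneg Q_nonneg) auto
  qed
  have p_sum: "(\<Sum>j<n. p k i j) = 1" if "i < n" for k i
    using that
  proof (induction k arbitrary: i)
    case 0
    have "(\<Sum>j<n. p 0 i j) = (\<Sum>j<n. if j = i then 1 else 0)"
      using 0 s by (intro sum.cong) (auto simp: p_def less_imp_neq[THEN not_sym])
    then show ?case using 0 by simp
  next
    case (Suc k)
    have "(\<Sum>j<n. p (Suc k) i j) = (\<Sum>j<n. \<Sum>l<n. Q k i l * p k l j)"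
      using Suc.prems by (intro sum.cong) (auto simp: p_Suc)
    also have "\<dots> = (\<Sum>l<n. Q k i l * (\<Sum>j<n. p k l j))"
      by (subst sum.swap) (simp add: sum_distrib_left)
    finally show ?case using Suc by (simp add: Q_sum)
  qed
  \<comment> \<open>For a fixed column \<open>j\<close>, the entries \<open>p k i j\<close> are
    values at the vertices \<open>i\<close> that each layer averages.\<close>
  have p_lim: "(\<lambda>k. p k i j - p k i' j) \<longlonglongrightarrow> 0" if "i < n" "i' < n" "j < n" for i i' j
  proof (rule averaging_consensus[where x = "\<lambda>k i. p k i j" and V = "{..<n}" and E = "parcs G"
        and Q = Q and \<epsilon> = \<epsilon> and m = m])
    fix k i l assume "(i, l) \<in> parcs G"
    then show "\<epsilon> \<le> Q k i l"
      using edge[of i l k] E by (auto simp: Q_def neighbours_def)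
  qed (use that E \<open>0 < \<epsilon>\<close> \<open>\<epsilon> \<le> 1\<close> \<open>0 < m\<close> walk Q_nonneg Q_sum p_Suc in auto)
  show ?thesis
  \<comment> \<open>Undoing the conjugation puts \<open>s i\<close> into the row scaling, where its
    positivity leaves the sign of \<open>\<gamma> k i\<close> unchanged, and \<open>1 / s j\<close>
    into the column weights.\<close>
  proof (rule smoothness_tendsto_0[where a = "\<lambda>k i. \<gamma> k i * s i" and p = p and w = "\<lambda>j. 1 / s j"])
    show "cumulative_attention n \<gamma> A k $$ (i, j) = \<gamma> k i * s i * p k i j * (1 / s j)"
      if "i < n" "j < n" for k i j
      using s[OF that(1)] s[OF that(2)] by (simp add: cumulative_attention_index[OF A that] p_def)
    show "sgn (\<gamma> k i * s i) = sgn (\<gamma> k j * s j)" if "i < n" "j < n" for k i j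
      using sgn[OF that, of k] s[OF that(1)] s[OF that(2)] by (simp add: sgn_mult)
  qed (use s p_nonneg p_sum p_lim cumulative_attention_carrier[OF A] in auto)
qed

section \<open>Bounds on attention scores, and GATv2\<close>

lemma abs_scalar_prod_le:
  fixes v w :: "real vec"
  assumes "v \<in> carrier_vec N" and "w \<in> carrier_vec N" and "0 \<le> a"
    and "\<And>i. i < N \<Longrightarrow> \<bar>v $ i\<bar> \<le> a" and "\<And>i. i < N \<Longrightarrow> \<bar>w $ i\<bar> \<le> b"
  shows "\<bar>v \<bullet> w\<bar> \<le> real N * (a * b)"
proof -
  have "\<bar>v \<bullet> w\<bar> \<le> (\<Sum>i<N. \<bar>v $ i * w $ i\<bar>)"
    using assms(2) by (simp add: scalar_prod_def atLeast0LessThan sum_abs)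
  also have "\<dots> \<le> (\<Sum>i<N. a * b)"
    using assms(3-5) by (intro sum_mono) (auto simp: abs_mult intro!: mult_mono)
  finally show ?thesis by simp
qed

lemma abs_append_rows_le:
  fixes H :: "real mat"
  assumes H: "H \<in> carrier_mat n d" "elements_mat H \<subseteq> {-C..C}"
    and "i < n" and "j < n" and "t < 2 * d"
  shows "\<bar>(row H i @\<^sub>v row H j) $ t\<bar> \<le> C"
proof -
  have "\<bar>H $$ (l, u)\<bar> \<le> C" if "l < n" "u < d" for l u
    using elements_matI[OF H(1) that refl] H(2) by (auto simp: abs_le_iff)
  then show ?thesis
    using assms(3-5) carrier_matD[OF H(1)] by (cases "t < d") auto
qed

lemma abs_vec_entry_le: "v \<in> carrier_vec N \<Longrightarrow> set\<^sub>v v \<subseteq> {-C..C} \<Longrightarrow> i < N \<Longrightarrow> \<bar>v $ i\<bar> \<le> (C :: real)"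
  using vec_setI[of v i "v $ i"] by (auto simp: abs_le_iff)

lemma sum_neighbours:
  fixes G :: "nat pair_pre_digraph"
  assumes "pair_pseudo_graph G" and "pverts G = {0..<n}"
  shows "(\<Sum>l<n. if l \<in> neighbours G i then f l else (0 :: real)) = sum f (neighbours G i)"
proof -
  have "neighbours G i \<subseteq> {..<n}"
    using neighbours_subset[OF assms(1), of i] assms(2) by auto
  then show ?thesis by (subst sum.inter_restrict[symmetric]) (auto simp: Int_absorb1)
qed

text \<open>Bounded features, parameters and widths confine the exponents of all layers to one
  interval \<open>[-K, K]\<close>. The softmax weights on the edges are then bounded below uniformly
  in the layer.\<close>

lemma smoothness_gatv2:
  fixes C :: real
  assumes G: "pair_pseudo_graph G" "pverts G = {0..<n}"
      "Digraph_Component.connected (with_proj G)" "\<not> bipartite_graph G"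
    and X: "X \<in> carrier_mat n (d 0)"
    and \<sigma>: "continuous_on {-C..C} \<sigma>"
    and "C \<ge> 0"
    and d: "\<And>k. d k \<le> D"
    and w: "\<And>k. w\<^sub>e (Suc k) \<in> carrier_vec (2 * d k)" "\<And>k. set\<^sub>v (w\<^sub>e (Suc k)) \<subseteq> {-C..C}"
    and W: "\<And>k. W (Suc k) \<in> carrier_mat (d k) (d (Suc k))"
    and H: "\<And>k. elements_mat (gatv2_H G \<sigma> w\<^sub>e W X k) \<subseteq> {-C..C}"
  shows "(\<lambda>k. smoothness (gatv2_T G \<sigma> w\<^sub>e W X k)) \<longlonglongrightarrow> 0"
proof -
  define h where "h = gatv2_H G \<sigma> w\<^sub>e W X"
  have card: "card (pverts G) = n" using G(2) by simp
  have h_carrier: "h k \<in> carrier_mat n (d k)" for k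
    unfolding h_def
  proof (induction k)
    case (Suc k)
    have "gatv2_attention G \<sigma> (w\<^sub>e (Suc k)) (gatv2_H G \<sigma> w\<^sub>e W X k) \<in> carrier_mat n n"
      by (simp add: gatv2_attention_def card)
    then show ?case using Suc W[of k] by simp
  qed (use X in simp)
  \<comment> \<open>Continuity on the compact interval that holds all features bounds the
    activation.\<close>
  have "\<exists>y\<in>{-C..C}. \<forall>x\<in>{-C..C}. \<bar>\<sigma> x\<bar> \<le> \<bar>\<sigma> y\<bar>"
    using \<sigma> \<open>C \<ge> 0\<close> by (intro continuous_attains_sup continuous_on_rabs) auto
  then obtain M where M: "\<And>x. x \<in> {-C..C} \<Longrightarrow> \<bar>\<sigma> x\<bar> \<le> M" by blast
  \<comment> \<open>Two concatenated rows have \<open>2 * d k\<close> entries; the width bound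
    \<open>D\<close> makes \<open>K\<close> independent of the layer.\<close>
  define K where "K = real (2 * D) * (C * M)"
  have "0 \<le> M" using M[of 0] \<open>C \<ge> 0\<close> by (auto intro: order_trans[OF abs_ge_zero])
  have exponent: "\<bar>w\<^sub>e (Suc k) \<bullet> map_vec \<sigma> (row (h k) i @\<^sub>v row (h k) j)\<bar> \<le> K"
    if "i < n" "j < n" for k i j
  proof -
    have "\<bar>w\<^sub>e (Suc k) \<bullet> map_vec \<sigma> (row (h k) i @\<^sub>v row (h k) j)\<bar> \<le> real (2 * d k) * (C * M)"
    proof (rule abs_scalar_prod_le[OF w(1) _ \<open>C \<ge> 0\<close>])
      show "map_vec \<sigma> (row (h k) i @\<^sub>v row (h k) j) \<in> carrier_vec (2 * d k)"
        using carrier_matD(2)[OF h_carrier[of k]] by (intro carrier_vecI) simp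
      fix t assume t: "t < 2 * d k"
      then show "\<bar>w\<^sub>e (Suc k) $ t\<bar> \<le> C" using abs_vec_entry_le[OF w] by blast
      have "(row (h k) i @\<^sub>v row (h k) j) $ t \<in> {-C..C}"
        using abs_append_rows_le[OF h_carrier, of k C i j t] H that t
        by (auto simp: h_def abs_le_iff)
      moreover have "t < dim_vec (row (h k) i @\<^sub>v row (h k) j)" using carrier_matD(2)[OF h_carrier[of k]] t by simp
      ultimately show "\<bar>map_vec \<sigma> (row (h k) i @\<^sub>v row (h k) j) $ t\<bar> \<le> M"
        using M by (metis index_map_vec(1))
    qed
    also have "\<dots> \<le> K"
      unfolding K_def using d[of k] \<open>C \<ge> 0\<close> \<open>0 \<le> M\<close> by (intro mult_right_mono) auto
    finally show ?thesis .
  qed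
  define sc where "sc k = gatv2_score \<sigma> (w\<^sub>e (Suc k)) (h k)" for k
  have sc_bounds: "exp (- K) \<le> sc k i j" "sc k i j \<le> exp K" if "i < n" "j < n" for k i j
    using exponent[OF that, of k] by (auto simp: sc_def gatv2_score_def abs_le_iff)
  define Z where "Z k i = (\<Sum>l \<in> neighbours G i. sc k i l)" for k i
  have nb: "neighbours G i \<subseteq> {..<n}" for i
    using neighbours_subset[OF G(1)] G(2) by (simp add: atLeast0LessThan)
  have Z: "0 < Z k i" "Z k i \<le> real n * exp K" if "i < n" for k i
  proof -
    have fin: "finite (neighbours G i)" by (rule finite_subset[OF nb]) simp
    have deg: "0 < card (neighbours G i)" "card (neighbours G i) \<le> n"
      using degree_of_bounds[OF G that] by (auto simp: degree_of_def)
    then show "0 < Z k i"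
      unfolding Z_def sc_def gatv2_score_def using fin by (intro sum_pos) auto
    have "Z k i \<le> real (card (neighbours G i)) * exp K"
      unfolding Z_def using sc_bounds(2)[OF that] nb by (intro sum_bounded_above) blast
    also have "\<dots> \<le> real n * exp K" using deg by (intro mult_right_mono) auto
    finally show "Z k i \<le> real n * exp K" .
  qed
  have A_Suc: "gatv2_A G \<sigma> w\<^sub>e W X (Suc k) $$ (i, l) = (if l \<in> neighbours G i then sc k i l / Z k i else 0)"
    if "i < n" "l < n" for k i l
    using that by (simp add: gatv2_A_def gatv2_attention_def card sc_def Z_def h_def)
  have "n \<noteq> 0"
    using G(2,3) by (auto simp: connected_def strongly_connected_def)
  show ?thesis
    unfolding gatv2_T_def card
  \<comment> \<open>The choice of \<epsilon> is the least possible score over the largest possible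
    sum of at most \<open>n\<close> scores.\<close>
  proof (rule smoothness_cumulative_attention[OF G, where s = "\<lambda>_. 1" and \<epsilon> = "exp (- K) / (real n * exp K)"])
    show "gatv2_A G \<sigma> w\<^sub>e W X k \<in> carrier_mat n n" for k
      by (simp add: gatv2_A_def gatv2_attention_def card)
    show "0 < exp (- K) / (real n * exp K)" using \<open>n \<noteq> 0\<close> by simp
    have "0 \<le> K" unfolding K_def using \<open>C \<ge> 0\<close> \<open>0 \<le> M\<close> by simp
    then have "exp (- K) \<le> 1 * exp K" by simp
    also have "\<dots> \<le> real n * exp K" using \<open>n \<noteq> 0\<close> by (intro mult_right_mono) auto
    finally show "exp (- K) / (real n * exp K) \<le> 1" using \<open>n \<noteq> 0\<close> by simp
    fix k i l assume "i < n"
    show "0 \<le> gatv2_A G \<sigma> w\<^sub>e W X (Suc k) $$ (i, l)" if "l < n"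
      unfolding A_Suc[OF \<open>i < n\<close> that] using Z(1)[OF \<open>i < n\<close>, of k]
      by (simp add: sc_def gatv2_score_def)
    show "(\<Sum>l<n. gatv2_A G \<sigma> w\<^sub>e W X (Suc k) $$ (i, l) * 1) = 1"
    proof -
      have "(\<Sum>l<n. gatv2_A G \<sigma> w\<^sub>e W X (Suc k) $$ (i, l) * 1)
          = (\<Sum>l<n. if l \<in> neighbours G i then sc k i l / Z k i else 0)"
        using \<open>i < n\<close> by (intro sum.cong) (auto simp: A_Suc)
      also have "\<dots> = Z k i / Z k i"
        unfolding sum_neighbours[OF G(1,2)] by (simp add: Z_def flip: sum_divide_distrib)
      finally show ?thesis using Z(1)[OF \<open>i < n\<close>, of k] by simp
    qed
    show "exp (- K) / (real n * exp K) \<le> gatv2_A G \<sigma> w\<^sub>e W X (Suc k) $$ (i, l) * 1 / 1"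
      if "l \<in> neighbours G i"
    proof -
      have "l < n" using that nb by auto
      have "0 \<le> sc k i l" by (simp add: sc_def gatv2_score_def)
      then have "exp (- K) / (real n * exp K) \<le> sc k i l / Z k i"
        using sc_bounds(1)[OF \<open>i < n\<close> \<open>l < n\<close>] Z[OF \<open>i < n\<close>, of k] by (intro frac_le) auto
      then show ?thesis using A_Suc[OF \<open>i < n\<close> \<open>l < n\<close>] that by simp
    qed
  qed auto
qed

section \<open>Symmetric normalisation, for GPRGNN and DAGNN\<close>

text \<open>Conjugation by the square roots of the degrees turns the normalised adjacency matrix
  into the transition matrix of the simple random walk, whose positive entries
  \<open>1 / degree_of G i\<close> are at least \<open>1 / n\<close>.\<close>

lemma smoothness_sym_norm:
  assumes G: "pair_pseudo_graph G" "pverts G = {0..<n}"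
      "Digraph_Component.connected (with_proj G)" "\<not> bipartite_graph G"
    and sgn: "\<And>k i j. i < n \<Longrightarrow> j < n \<Longrightarrow> sgn (\<gamma> k i) = sgn (\<gamma> k j)"
  shows "(\<lambda>k. smoothness (cumulative_attention n \<gamma> (\<lambda>_. sym_norm_attention G) k)) \<longlonglongrightarrow> 0"
proof -
  define s where "s i = sqrt (real (degree_of G i))" for i
  have card: "card (pverts G) = n" using G(2) by simp
  have s: "0 < s i" if "i < n" for i
    using degree_of_bounds[OF G that] by (simp add: s_def)
  have s_sq: "s i * s i = real (degree_of G i)" for i by (simp add: s_def)
  have nb: "neighbours G i \<subseteq> {..<n}" for i
    using neighbours_subset[OF G(1)] G(2) by (simp add: atLeast0LessThan)
  have entry: "sym_norm_attention G $$ (i, l) = (if l \<in> neighbours G i then 1 / (s i * s l) else 0)"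
    if "i < n" "l < n" for i l
    using that by (simp add: sym_norm_attention_def card s_def real_sqrt_mult)
  have "n \<noteq> 0"
    using G(2,3) by (auto simp: connected_def strongly_connected_def)
  show ?thesis
  proof (rule smoothness_cumulative_attention[OF G, where s = s and \<epsilon> = "1 / real n"])
    show "sym_norm_attention G \<in> carrier_mat n n" by (simp add: sym_norm_attention_def card)
    fix i l assume i: "i < n"
    show "0 \<le> sym_norm_attention G $$ (i, l)" if "l < n"
      using s[OF i] s[OF that] by (simp add: entry[OF i that])
    have "(\<Sum>l<n. sym_norm_attention G $$ (i, l) * s l)
        = (\<Sum>l<n. if l \<in> neighbours G i then 1 / s i else 0)"
      using s i by (intro sum.cong) (auto simp: entry less_imp_neq[THEN not_sym])
    also have "\<dots> = real (degree_of G i) / s i"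
      unfolding sum_neighbours[OF G(1,2)] by (simp add: degree_of_def)
    also have "\<dots> = s i" using s[OF i] by (simp flip: s_sq)
    finally show "(\<Sum>l<n. sym_norm_attention G $$ (i, l) * s l) = s i" .
    show "1 / real n \<le> sym_norm_attention G $$ (i, l) * s l / s i" if "l \<in> neighbours G i"
    proof -
      have "l < n" using that nb by auto
      then have "sym_norm_attention G $$ (i, l) * s l / s i = 1 / real (degree_of G i)"
        using s[OF \<open>l < n\<close>] s[OF i] that by (simp add: entry[OF i] flip: s_sq)
      then show ?thesis using degree_of_bounds[OF G i] by (simp add: frac_le)
    qed
    show "sgn (\<gamma> k i) = sgn (\<gamma> k j)" if "i < n" "j < n" for k i j
      using that by (rule sgn)
  qed (use s \<open>n \<noteq> 0\<close> in auto)
qed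

section \<open>Geometric decay, for FAGCN\<close>

text \<open>Entrywise, the product of \<open>k\<close> attention matrices is dominated by \<open>t ^ k\<close> times a power of the
  symmetrically normalised adjacency matrix, for which the square roots of the degrees form an
  eigenvector with eigenvalue one.\<close>

lemma cumulative_attention_tendsto_0:
  assumes G: "pair_pseudo_graph G" "pverts G = {0..<n}"
      "Digraph_Component.connected (with_proj G)" "\<not> bipartite_graph G"
    and A: "\<And>k. A k \<in> carrier_mat n n"
    and "0 \<le> t" and "t < 1"
    and bound: "\<And>k i l. i < n \<Longrightarrow> l < n \<Longrightarrow> \<bar>A (Suc k) $$ (i, l)\<bar>
      \<le> (if l \<in> neighbours G i then t / sqrt (real (degree_of G i) * real (degree_of G l)) else 0)"
    and "i < n" and "j < n"
  shows "(\<lambda>k. cumulative_attention n (\<lambda>_ _. c) A k $$ (i, j)) \<longlonglongrightarrow> 0"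
proof -
  define s where "s i = sqrt (real (degree_of G i))" for i
  have s: "0 < s i" if "i < n" for i
    using degree_of_bounds[OF G that] by (simp add: s_def)
  have s_sq: "s i * s i = real (degree_of G i)" for i by (simp add: s_def)
  \<comment> \<open>The factor \<open>s i / s j\<close> fits the identity matrix at
    \<open>k = 0\<close>, with equality on the diagonal, and is reproduced by every layer because
    \<open>s\<close> is an eigenvector.\<close>
  have prod_le: "\<bar>attention_prod n A k $$ (i, j)\<bar> \<le> t ^ k * (s i / s j)" if "i < n" for k i
    using that
  proof (induction k arbitrary: i)
    case 0
    then show ?case using s \<open>j < n\<close> by (auto simp: less_imp_le less_imp_neq[THEN not_sym])
  next
    case (Suc k)
    have "\<bar>attention_prod n A (Suc k) $$ (i, j)\<bar>
        \<le> (\<Sum>l<n. \<bar>A (Suc k) $$ (i, l)\<bar> * \<bar>attention_prod n A k $$ (l, j)\<bar>)"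
      unfolding attention_prod_Suc_index[OF A Suc.prems \<open>j < n\<close>] abs_mult[symmetric] by (rule sum_abs)
    \<comment> \<open>Once \<open>s l\<close> cancels, the bound is the same for each of the
      \<open>s i * s i\<close> neighbours of \<open>i\<close>.\<close>
    also have "\<dots> \<le> (\<Sum>l<n. if l \<in> neighbours G i then t ^ Suc k / (s i * s j) else 0)"
    proof (rule sum_mono)
      fix l assume "l \<in> {..<n}"
      then have l: "l < n" by simp
      have "\<bar>A (Suc k) $$ (i, l)\<bar> * \<bar>attention_prod n A k $$ (l, j)\<bar>
          \<le> (if l \<in> neighbours G i then t / (s i * s l) else 0) * (t ^ k * (s l / s j))"
        using bound[OF Suc.prems l, of k] Suc.IH[OF l] s[OF Suc.prems] s[OF l] \<open>0 \<le> t\<close>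
        by (intro mult_mono) (auto simp: s_def real_sqrt_mult)
      also have "\<dots> = (if l \<in> neighbours G i then t ^ Suc k / (s i * s j) else 0)"
        using s[OF l] by simp
      finally show "\<bar>A (Suc k) $$ (i, l)\<bar> * \<bar>attention_prod n A k $$ (l, j)\<bar> \<le> \<dots>" .
    qed
    also have "\<dots> = (s i * s i) * (t ^ Suc k / (s i * s j))"
      unfolding sum_neighbours[OF G(1,2)] s_sq by (simp add: degree_of_def)
    also have "\<dots> = t ^ Suc k * (s i / s j)" using s[OF Suc.prems] by simp
    finally show ?case .
  qed
  have "(\<lambda>k. t ^ k * (s i / s j)) \<longlonglongrightarrow> 0"
    using \<open>0 \<le> t\<close> \<open>t < 1\<close> by (intro tendsto_mult_left_zero LIMSEQ_power_zero) auto
  then show ?thesis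
  proof (rule tendsto_0_le[where K = "\<bar>c\<bar>"], intro always_eventually allI)
    fix k
    have "norm (cumulative_attention n (\<lambda>_ _. c) A k $$ (i, j))
        = \<bar>attention_prod n A k $$ (i, j)\<bar> * \<bar>c\<bar>"
      by (simp add: cumulative_attention_index[OF A \<open>i < n\<close> \<open>j < n\<close>] abs_mult)
    also have "\<dots> \<le> norm (t ^ k * (s i / s j)) * \<bar>c\<bar>"
      unfolding real_norm_def
      by (intro mult_right_mono order_trans[OF prod_le[OF \<open>i < n\<close>] abs_ge_self]) simp
    finally show "norm (cumulative_attention n (\<lambda>_ _. c) A k $$ (i, j)) \<le> \<dots>" .
  qed
qed

text \<open>The states and edge parameters are bounded and the width \<open>d\<close> is common to
  all layers, so one \<open>K\<close> bounds the arguments of all hyperbolic tangents, and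
  \<open>tanh K\<close> is a decay rate below one that serves every layer.\<close>

lemma fagcn_tendsto_0:
  fixes C :: real
  assumes G: "pair_pseudo_graph G" "pverts G = {0..<n}"
      "Digraph_Component.connected (with_proj G)" "\<not> bipartite_graph G"
    and "0 \<le> C"
    and H\<^sub>0: "H\<^sub>0 \<in> carrier_mat n d"
    and w: "\<And>k. w\<^sub>e (Suc k) \<in> carrier_vec (2 * d)" "\<And>k. set\<^sub>v (w\<^sub>e (Suc k)) \<subseteq> {-C..C}"
    and Z: "\<And>k. elements_mat (fagcn_Z G c w\<^sub>e H\<^sub>0 k) \<subseteq> {-C..C}"
    and "i < n" and "j < n"
  shows "(\<lambda>k. fagcn_T G c w\<^sub>e H\<^sub>0 k $$ (i, j)) \<longlonglongrightarrow> 0"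
proof -
  have card: "card (pverts G) = n" using G(2) by simp
  have Z_carrier: "fagcn_Z G c w\<^sub>e H\<^sub>0 k \<in> carrier_mat n d" for k
  proof (induction k)
    case (Suc k)
    have "fagcn_attention G (w\<^sub>e (Suc k)) (fagcn_Z G c w\<^sub>e H\<^sub>0 k) \<in> carrier_mat n n"
      by (simp add: fagcn_attention_def card)
    then show ?case using Suc by (simp add: add_carrier_mat)
  qed (use H\<^sub>0 in simp)
  define K where "K = real (2 * d) * (C * C)"
  show ?thesis
    unfolding fagcn_T_def card
  proof (rule cumulative_attention_tendsto_0[OF G, where t = "tanh K"])
    show "fagcn_A G c w\<^sub>e H\<^sub>0 k \<in> carrier_mat n n" for k
      by (simp add: fagcn_A_def fagcn_attention_def card)
    show "0 \<le> tanh K" using \<open>0 \<le> C\<close> by (simp add: K_def)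
    show "tanh K < 1" by (rule tanh_real_lt_1)
    fix k i l assume il: "i < n" "l < n"
    let ?Z = "fagcn_Z G c w\<^sub>e H\<^sub>0 k"
    have "\<bar>w\<^sub>e (Suc k) \<bullet> (row ?Z i @\<^sub>v row ?Z l)\<bar> \<le> K"
      unfolding K_def
    proof (rule abs_scalar_prod_le[OF w(1) _ \<open>0 \<le> C\<close>])
      show "row ?Z i @\<^sub>v row ?Z l \<in> carrier_vec (2 * d)"
        using carrier_matD(2)[OF Z_carrier[of k]] by (intro carrier_vecI) simp
      fix t assume t: "t < 2 * d"
      show "\<bar>w\<^sub>e (Suc k) $ t\<bar> \<le> C" using abs_vec_entry_le[OF w t] .
      show "\<bar>(row ?Z i @\<^sub>v row ?Z l) $ t\<bar> \<le> C" by (rule abs_append_rows_le[OF Z_carrier Z il t])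
    qed
    \<comment> \<open>The function \<open>tanh\<close> is odd and increasing, so the bound on its
      argument carries over to its absolute value.\<close>
    then have "\<bar>tanh (w\<^sub>e (Suc k) \<bullet> (row ?Z i @\<^sub>v row ?Z l))\<bar> \<le> tanh K"
      by (simp flip: tanh_real_abs)
    then show "\<bar>fagcn_A G c w\<^sub>e H\<^sub>0 (Suc k) $$ (i, l)\<bar>
        \<le> (if l \<in> neighbours G i then tanh K / sqrt (real (degree_of G i) * real (degree_of G l)) else 0)"
      using il by (simp add: fagcn_A_def fagcn_attention_def card abs_divide divide_right_mono)
  qed (use assms(10,11) in auto)
qed

section \<open>The four models brought together\<close>

theorem theorem2:
  fixes G :: "nat pair_pre_digraph"
    and n d\<^sub>x :: nat
    and X :: "real mat"
    and \<sigma> :: "real \<Rightarrow> real"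
    and C :: real
  assumes "pair_pseudo_graph G"
    and "pverts G = {0..<n}"
    and "Digraph_Component.connected (with_proj G)"
    and "\<not> bipartite_graph G"
    and "X \<in> carrier_mat n d\<^sub>x"
    and "\<forall>i<n. \<forall>j<n. i \<noteq> j \<longrightarrow> row X i \<noteq> row X j"
    and "continuous_on UNIV \<sigma>"
    and "C > 0"
  shows
    "(\<forall>(d :: nat \<Rightarrow> nat) D w\<^sub>e W.
        d 0 = d\<^sub>x \<and> (\<forall>k. d k \<le> D) \<and>
        (\<forall>k\<ge>1. w\<^sub>e k \<in> carrier_vec (2 * d (k - 1)) \<and> set\<^sub>v (w\<^sub>e k) \<subseteq> {-C..C}) \<and>
        (\<forall>k\<ge>1. W k \<in> carrier_mat (d (k - 1)) (d k) \<and> elements_mat (W k) \<subseteq> {-C..C}) \<and>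
        (\<forall>k. elements_mat (gatv2_H G \<sigma> w\<^sub>e W X k) \<subseteq> {-C..C})
        \<longrightarrow> (\<lambda>k. smoothness (gatv2_T G \<sigma> w\<^sub>e W X k)) \<longlonglongrightarrow> 0)
   \<and> (\<forall>d H\<^sub>0 c.
        mlp_output \<sigma> C X d H\<^sub>0 \<and>
        (\<forall>k\<ge>1. c k \<in> {-C..C}) \<and>
        (\<forall>k. elements_mat (propagate_H G H\<^sub>0 k) \<subseteq> {-C..C})
        \<longrightarrow> (\<lambda>k. smoothness (gprgnn_T G c k)) \<longlonglongrightarrow> 0)
   \<and> (\<forall>d H\<^sub>0 w\<^sub>h.
        mlp_output \<sigma> C X d H\<^sub>0 \<and>
        w\<^sub>h \<in> carrier_vec d \<and> set\<^sub>v w\<^sub>h \<subseteq> {-C..C} \<and>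
        (\<forall>k. elements_mat (propagate_H G H\<^sub>0 k) \<subseteq> {-C..C})
        \<longrightarrow> (\<lambda>k. smoothness (dagnn_T G w\<^sub>h H\<^sub>0 k)) \<longlonglongrightarrow> 0)
   \<and> (\<forall>d W\<^sub>1 w\<^sub>e c.
        W\<^sub>1 \<in> carrier_mat d\<^sub>x d \<and> elements_mat W\<^sub>1 \<subseteq> {-C..C} \<and>
        (\<forall>k\<ge>1. w\<^sub>e k \<in> carrier_vec (2 * d) \<and> set\<^sub>v (w\<^sub>e k) \<subseteq> {-C..C}) \<and>
        elements_mat (fagcn_H0 \<sigma> W\<^sub>1 X) \<subseteq> {-C..C} \<and>
        (\<forall>k. elements_mat (fagcn_Z G c w\<^sub>e (fagcn_H0 \<sigma> W\<^sub>1 X) k) \<subseteq> {-C..C})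
        \<longrightarrow> (\<forall>i<n. \<forall>j<n. (\<lambda>k. fagcn_T G c w\<^sub>e (fagcn_H0 \<sigma> W\<^sub>1 X) k $$ (i, j)) \<longlonglongrightarrow> 0))"
proof (intro conjI allI impI; (elim conjE)?)
  note G = assms(1-4)
  have card: "card (pverts G) = n" using assms(2) by simp
  {
    fix d :: "nat \<Rightarrow> nat" and D w\<^sub>e W
    assume d0: "d 0 = d\<^sub>x" and d: "\<forall>k. d k \<le> D"
      and w: "\<forall>k\<ge>1. w\<^sub>e k \<in> carrier_vec (2 * d (k - 1)) \<and> set\<^sub>v (w\<^sub>e k) \<subseteq> {-C..C}"
      and W: "\<forall>k\<ge>1. W k \<in> carrier_mat (d (k - 1)) (d k) \<and> elements_mat (W k) \<subseteq> {-C..C}"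
      and H: "\<forall>k. elements_mat (gatv2_H G \<sigma> w\<^sub>e W X k) \<subseteq> {-C..C}"
    show "(\<lambda>k. smoothness (gatv2_T G \<sigma> w\<^sub>e W X k)) \<longlonglongrightarrow> 0"
    proof (rule smoothness_gatv2[OF G, where d = d and C = C and D = D])
      show "continuous_on {-C..C} \<sigma>" using assms(7) by (rule continuous_on_subset) simp
      \<comment> \<open>Layers count from one, so the hypotheses are taken at \<open>Suc k\<close>,
        where \<open>k - 1\<close> becomes the index of the incoming features.\<close>
      fix k
      show "w\<^sub>e (Suc k) \<in> carrier_vec (2 * d k)" "set\<^sub>v (w\<^sub>e (Suc k)) \<subseteq> {-C..C}"
        "W (Suc k) \<in> carrier_mat (d k) (d (Suc k))"
        using w[rule_format, of "Suc k"] W[rule_format, of "Suc k"] by auto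
    qed (use assms d0 d H in auto)
  next
    fix c :: "nat \<Rightarrow> real"
    \<comment> \<open>All rows of a layer share one coefficient and hence its sign, also when it is
      zero.\<close>
    show "(\<lambda>k. smoothness (gprgnn_T G c k)) \<longlonglongrightarrow> 0"
      unfolding gprgnn_T_def card by (rule smoothness_sym_norm[OF G]) simp
  next
    fix w\<^sub>h H\<^sub>0
    \<comment> \<open>Positivity gives every hop attention the sign one, although its value varies
      with the row.\<close>
    have "0 < sigmoid x" for x by (simp add: sigmoid_def add_pos_pos)
    then show "(\<lambda>k. smoothness (dagnn_T G w\<^sub>h H\<^sub>0 k)) \<longlonglongrightarrow> 0"
      unfolding dagnn_T_def card by (intro smoothness_sym_norm[OF G]) simp
  next
    fix d W\<^sub>1 w\<^sub>e c i j
    assume W: "W\<^sub>1 \<in> carrier_mat d\<^sub>x d"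
      and w: "\<forall>k\<ge>1. w\<^sub>e k \<in> carrier_vec (2 * d) \<and> set\<^sub>v (w\<^sub>e k) \<subseteq> {-C..C}"
      and Z: "\<forall>k. elements_mat (fagcn_Z G c w\<^sub>e (fagcn_H0 \<sigma> W\<^sub>1 X) k) \<subseteq> {-C..C}"
      and ij: "i < n" "j < n"
    show "(\<lambda>k. fagcn_T G c w\<^sub>e (fagcn_H0 \<sigma> W\<^sub>1 X) k $$ (i, j)) \<longlonglongrightarrow> 0"
    proof (rule fagcn_tendsto_0[OF G, where d = d and C = C])
      show "fagcn_H0 \<sigma> W\<^sub>1 X \<in> carrier_mat n d" using W assms(5) by (simp add: fagcn_H0_def)
    qed (use assms(8) w Z ij in auto)
  }
qed

end
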